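(* Each of the following tied six-blades $XY$ (left end $X$, right end $Y$) is of Type I, i.e. consists of more than one separated part: $A1A1, A1B1, A1B2, A1B3, A1C1, A1C3, A1C5$; $A2A2, A2B1, A2B2, A2B3, A2C2, A2C4, A2C6$; $B1B1, B1C1, B1C4, B1D3, B1E1, B1E2$; $B2B2, B2C2, B2C5, B2D1, B2E1, B2E2$; $B3B3, B3C3, B3C6, B3E1, B3E2$; $C1C1, C1C2, C1C6, C1D1, C1D2$; $C2C2, C2C3, C2D2, C2D3$; $C3C3, C3C4, C3D1, C3D3$; $C4C4, C4C5, C4D1, C4D2$; $C5C5, C5C6, C5D2, C5D3$; $C6C6, C6D1, C6D3$; $D1D1, D1E1, D1E2$; $D2D2, D2E1, D2E2$; $D3D3, D3E1, D3E2$; $E1E1, E1E2$; $E2E2$.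
   Context: There are six blades numbered $1,\dots,6$, each with a left end and a right end. The six left ends are tied in pairs and the six right ends are tied in pairs. A tying pattern on one side is a partition of $\{1,\dots,6\}$ into three pairs (the columns of the "matrix" of that end). The named patterns are, writing $ij$ for the pair $\{i,j\}$: $A1=\{12,34,56\}$, $A2=\{16,23,45\}$, $B1=\{12,36,45\}$, $B2=\{14,23,56\}$, $B3=\{16,25,34\}$, $C1=\{12,35,46\}$, $C2=\{15,23,46\}$, $C3=\{15,26,34\}$, $C4=\{13,26,45\}$, $C5=\{13,24,56\}$, $C6=\{16,24,35\}$, $D1=\{14,26,35\}$, $D2=\{13,25,46\}$, $D3=\{15,24,36\}$, $E1=E2=\{14,25,36\}$ ($E1$ and $E2$ have the same pairs and differ only in how they are drawn in the plane, which is irrelevant here). The tied six-blade $XY$ is obtained by tying the left ends according to $X$ and the right ends according to $Y$; its parts are the closed loops obtained, i.e. the connected components of the multigraph on the vertex set $\{1,\dots,6\}$ whose edges are the three pairs of $X$ together with the three pairs of $Y$. The tied six-blade is of Type I if it consists of more than one separated part (at least two such closed loops; different loops may be linked in space), and of Type II otherwise. *)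

theory Defs
  imports Main "HOL-Library.Disjoint_Sets"
begin

definition blades :: "nat set" where
  "blades = {1..6}"

definition tying_pattern :: "nat set set \<Rightarrow> bool" where
  "tying_pattern P \<longleftrightarrow> partition_on blades P \<and> card P = 3 \<and> (\<forall>p\<in>P. card p = 2)"

datatype end_name = A1 | A2 | B1 | B2 | B3 | C1 | C2 | C3 | C4 | C5 | C6 | D1 | D2 | D3 | E1 | E2

text \<open>\<open>E1\<close> and \<open>E2\<close> are different drawings of the same pairing, hence distinct names
  with equal values.\<close>

fun pairs :: "end_name \<Rightarrow> nat set set" where
  "pairs A1 = {{1,2}, {3,4}, {5,6}}"
| "pairs A2 = {{1,6}, {2,3}, {4,5}}"
| "pairs B1 = {{1,2}, {3,6}, {4,5}}"
| "pairs B2 = {{1,4}, {2,3}, {5,6}}"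
| "pairs B3 = {{1,6}, {2,5}, {3,4}}"
| "pairs C1 = {{1,2}, {3,5}, {4,6}}"
| "pairs C2 = {{1,5}, {2,3}, {4,6}}"
| "pairs C3 = {{1,5}, {2,6}, {3,4}}"
| "pairs C4 = {{1,3}, {2,6}, {4,5}}"
| "pairs C5 = {{1,3}, {2,4}, {5,6}}"
| "pairs C6 = {{1,6}, {2,4}, {3,5}}"
| "pairs D1 = {{1,4}, {2,6}, {3,5}}"
| "pairs D2 = {{1,3}, {2,5}, {4,6}}"
| "pairs D3 = {{1,5}, {2,4}, {3,6}}"
| "pairs E1 = {{1,4}, {2,5}, {3,6}}"
| "pairs E2 = {{1,4}, {2,5}, {3,6}}"

lemma tying_pattern_pairs: "tying_pattern (pairs X)"
proof -
  have blades: "blades = {1,2,3,4,5,6}"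
    by (auto simp: blades_def)
  show ?thesis
    by (cases X)
      (auto simp: tying_pattern_def partition_on_def disjoint_def blades doubleton_eq_iff)
qed

text \<open>The tied six-blade is a multigraph on the blades. Its edge set is the disjoint sum of the
  left and the right pairs, so a pair tied at both ends gives two parallel edges.\<close>

definition edges :: "nat set set \<Rightarrow> nat set set \<Rightarrow> (nat set + nat set) set" where
  "edges X Y = X <+> Y"

definition ends :: "nat set + nat set \<Rightarrow> nat set" where
  "ends = case_sum id id"

definition adjacency :: "nat set set \<Rightarrow> nat set set \<Rightarrow> nat rel" where
  "adjacency X Y = {(u, v). \<exists>e\<in>edges X Y. ends e = {u, v}}"

definition connectivity :: "nat set set \<Rightarrow> nat set set \<Rightarrow> nat rel" where
  "connectivity X Y = (adjacency X Y)\<^sup>* \<inter> blades \<times> blades"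

lemma equiv_connectivity: "equiv blades (connectivity X Y)"
proof -
  have "sym (adjacency X Y)"
    by (auto simp: sym_def adjacency_def insert_commute)
  then have "sym ((adjacency X Y)\<^sup>*)"
    by (rule sym_rtrancl)
  then show ?thesis
    by (auto simp: equiv_def refl_on_def sym_def trans_def connectivity_def)
qed

text \<open>A closed loop is represented by the set of blades it runs through.\<close>

definition parts :: "nat set set \<Rightarrow> nat set set \<Rightarrow> nat set set" where
  "parts X Y = blades // connectivity X Y"

definition type_I :: "nat set set \<Rightarrow> nat set set \<Rightarrow> bool" where
  "type_I X Y \<longleftrightarrow> card (parts X Y) > 1"

definition type_II :: "nat set set \<Rightarrow> nat set set \<Rightarrow> bool" where
  "type_II X Y \<longleftrightarrow> \<not> type_I X Y"

end

theory Submission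
  imports Defs
begin

text \<open>A pair tied at both ends is closed under adjacency, because no other pair of either pattern
  meets it. It is therefore separated from the remaining four blades, and all the listed patterns
  share such a pair.\<close>

text \<open>Every tied pair that meets \<open>S\<close> lies inside \<open>S\<close>, so no
  adjacency step leaves \<open>S\<close>; induction along a path extends this to connectivity.
  Exhibiting such an \<open>S\<close> thus proves two blades unconnected.\<close>

lemma connectivity_closed:
  assumes closed: "\<And>q. q \<in> X \<union> Y \<Longrightarrow> q \<inter> S \<noteq> {} \<Longrightarrow> q \<subseteq> S"
    and conn: "(u, v) \<in> connectivity X Y" and "u \<in> S"
  shows "v \<in> S"
proof -
  have step: "w \<in> S" if "(v, w) \<in> adjacency X Y" "v \<in> S" for v w
  proof -
    from that(1) have "{v, w} \<in> X \<union> Y"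
      by (auto simp: adjacency_def edges_def ends_def)
    with closed[of "{v, w}"] that(2) show ?thesis
      by blast
  qed
  from conn have "(u, v) \<in> (adjacency X Y)\<^sup>*"
    by (simp add: connectivity_def)
  then show ?thesis
    using \<open>u \<in> S\<close> by induction (auto intro: step)
qed

text \<open>Unconnected blades have distinct equivalence classes, which are two different
  parts.\<close>

lemma type_I_if_separated:
  assumes "u \<in> blades" "v \<in> blades" and sep: "(u, v) \<notin> connectivity X Y"
  shows "type_I X Y"
proof -
  let ?R = "connectivity X Y"
  have "{?R `` {u}, ?R `` {v}} \<subseteq> parts X Y"
    using assms(1,2) by (auto simp: parts_def intro: quotientI)
  moreover have "?R `` {u} \<noteq> ?R `` {v}"
    using sep eq_equiv_class_iff[OF equiv_connectivity assms(1,2)] by blast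
  \<comment> \<open>Finiteness matters because \<open>card\<close> of an infinite set is 0, so a
    two-element subset alone would give no lower bound.\<close>
  moreover have "finite (parts X Y)"
    unfolding parts_def
    by (rule finite_quotient) (auto simp: blades_def connectivity_def)
  ultimately show ?thesis
    unfolding type_I_def using card_mono[of "parts X Y" "{?R `` {u}, ?R `` {v}}"] by simp
qed

lemma type_I_if_common_pair:
  assumes X: "tying_pattern X" and Y: "tying_pattern Y" and p: "p \<in> X" "p \<in> Y"
  shows "type_I X Y"
proof -
  have "p \<subseteq> blades" "card p = 2"
    using X p by (auto simp: tying_pattern_def partition_on_def)
  \<comment> \<open>Cardinality 2 differs from both 0 and 6, so there is a blade inside
    \<open>p\<close> and one outside it.\<close>
  then have "p \<noteq> {}" "p \<noteq> blades"
    by (auto simp: blades_def)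
  then obtain u v where uv: "u \<in> p" "v \<in> blades" "v \<notin> p"
    using \<open>p \<subseteq> blades\<close> by blast
  \<comment> \<open>Whichever pattern contains \<open>q\<close> also contains \<open>p\<close>, and
    distinct pairs of one pattern are disjoint.\<close>
  have "q \<subseteq> p" if "q \<in> X \<union> Y" "q \<inter> p \<noteq> {}" for q
  proof -
    have "disjoint X" "disjoint Y"
      using X Y by (auto simp: tying_pattern_def partition_on_def)
    then have "q = p"
      using that p disjointD[of X q p] disjointD[of Y q p] by blast
    then show ?thesis
      by simp
  qed
  then have "(u, v) \<notin> connectivity X Y"
    using connectivity_closed[of X Y p u v] uv by blast
  then show ?thesis
    using type_I_if_separated uv \<open>p \<subseteq> blades\<close> by blast
qed

theorem theorem1:
  shows "\<forall>(X, Y) \<in> {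
    (A1, A1), (A1, B1), (A1, B2), (A1, B3), (A1, C1), (A1, C3), (A1, C5),
    (A2, A2), (A2, B1), (A2, B2), (A2, B3), (A2, C2), (A2, C4), (A2, C6),
    (B1, B1), (B1, C1), (B1, C4), (B1, D3), (B1, E1), (B1, E2),
    (B2, B2), (B2, C2), (B2, C5), (B2, D1), (B2, E1), (B2, E2),
    (B3, B3), (B3, C3), (B3, C6), (B3, E1), (B3, E2),
    (C1, C1), (C1, C2), (C1, C6), (C1, D1), (C1, D2),
    (C2, C2), (C2, C3), (C2, D2), (C2, D3),
    (C3, C3), (C3, C4), (C3, D1), (C3, D3),
    (C4, C4), (C4, C5), (C4, D1), (C4, D2),
    (C5, C5), (C5, C6), (C5, D2), (C5, D3),
    (C6, C6), (C6, D1), (C6, D3),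
    (D1, D1), (D1, E1), (D1, E2),
    (D2, D2), (D2, E1), (D2, E2),
    (D3, D3), (D3, E1), (D3, E2),
    (E1, E1), (E1, E2),
    (E2, E2)}.
    type_I (pairs X) (pairs Y)"
proof -
  have common: "type_I (pairs X) (pairs Y)" if "pairs X \<inter> pairs Y \<noteq> {}" for X Y
    using that type_I_if_common_pair[OF tying_pattern_pairs tying_pattern_pairs] by blast
  show ?thesis
    \<comment> \<open>The finite quantifier unfolds into one goal per listed tied six-blade. In
      each, \<open>Int_insert_left\<close> tests the left pairs for membership on the right, where a
      shared pair appears as the same term.\<close>
    by (simp only: ball_simps prod.case simp_thms; intro conjI common; simp add: Int_insert_left)
qed

end
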